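(* Let $\alpha: I\subset\mathbb{R}\to SO^3$ be a regular curve parametrized by arc length $s$ in the three-dimensional Lie group $SO^3$ with its bi-invariant metric $\langle\,,\rangle$, with Frenet vector fields $\{T,N,B\}$ and curvatures $\varkappa,\tau$. If the two-component spinor $\phi$ along $\alpha$ represents the triad $\{N,B,T\}$, then the Frenet equations $$\frac{dT}{ds}=\varkappa N,\qquad \frac{dN}{ds}=-\varkappa T+\left(\tau-\tfrac12\right)B,\qquad \frac{dB}{ds}=-\left(\tau-\tfrac12\right)N$$ are equivalent to the single spinor equation $$\frac{d\phi}{ds}=-i\,\frac{\tau-\frac12}{2}\,\phi+\frac{\varkappa}{2}\,\widehat{\phi}.$$
   Context: $SO^3$ denotes the rotation group $SO(3)$ with the bi-invariant metric and orientation normalized so that $\tau_G:=\frac12\langle[T,N],B\rangle=\frac12$ for every curve, i.e. there is a positively oriented orthonormal basis $\{X_1,X_2,X_3\}$ of the Lie algebra $\mathfrak g$ with $[X_1,X_2]=X_3$, $[X_2,X_3]=X_1$, $[X_3,X_1]=X_2$. Fix such a basis. Let $D$ be the Levi-Civita connection, so that $D_XY=\frac12[X,Y]$ for $X,Y\in\mathfrak g$ (left-invariant vector fields). A vector field along $\alpha$ is written $W=\sum_i w_iX_i$ with smooth functions $w_i:I\to\mathbb R$, and is identified with $(w_1,w_2,w_3)\in\mathbb R^3$. The bracket of two such fields is taken pointwise, $[W,Z]=\sum_{i,j}w_iz_j[X_i,X_j]$. The notation $\frac{dW}{ds}=\dot W=\sum_i\dot w_iX_i$ means the componentwise derivative;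 the covariant derivative is $D_{\alpha'}W=\dot W+\frac12[T,W]$, where $T=\alpha'$. The Frenet apparatus $(T,N,B,\varkappa,\tau)$ of the arc-length curve $\alpha$ consists of $T=\alpha'$, the orthonormal, positively oriented frame $\{T,N,B\}$ and the curvatures $\varkappa=\|\dot T\|$ (nonzero, so that the frame is defined) and $\tau$, for which $D_TT=\varkappa N$, $D_TN=-\varkappa T+\tau B$, $D_TB=-\tau N$. A spinor is a column $\phi=\begin{pmatrix}\phi_1\\ \phi_2\end{pmatrix}\in\mathbb C^2$; its mate is $\widehat\phi=\begin{pmatrix}-\overline{\phi_2}\\ \overline{\phi_1}\end{pmatrix}$. Let $\sigma=(\sigma_1,\sigma_2,\sigma_3)$ with $\sigma_1=\begin{pmatrix}1&0\\0&-1\end{pmatrix}$, $\sigma_2=\begin{pmatrix}i&0\\0&i\end{pmatrix}$, $\sigma_3=\begin{pmatrix}0&-1\\-1&0\end{pmatrix}$, and for spinors $\psi,\phi$ let $\psi^t\sigma\phi=(\psi^t\sigma_1\phi,\psi^t\sigma_2\phi,\psi^t\sigma_3\phi)\in\mathbb C^3$. A spinor $\phi$ along $\alpha$ (a differentiable function $I\to\mathbb C^2$) represents the triad $\{N,B,T\}$ if at each point $N+iB=\phi^t\sigma\phi$ and $T=-\widehat\phi^{\,t}\sigma\phi$, with $\overline{\phi}^{\,t}\phi=1$. Such a spinor is determined up to sign. *)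

theory Defs
  imports "HOL-Analysis.Analysis"
begin

section \<open>The rotation group and its bi-invariant metric\<close>

type_synonym mat3 = "real^3^3"

definition SO3 :: "mat3 set" where
  "SO3 = {p. rotation_matrix p}"

definition so3 :: "mat3 set" where
  "so3 = {A. transpose A = - A}"

definition lie_bracket :: "mat3 \<Rightarrow> mat3 \<Rightarrow> mat3" where
  "lie_bracket A C = A ** C - C ** A"

text \<open>The left-invariant vector field extending \<open>A \<in> so3\<close> takes the value \<open>p ** A\<close> at \<open>p\<close>, so
  the tangent space at \<open>p\<close>, as a space of matrices, is the left translate of \<open>so3\<close>.\<close>

definition tangent_SO3 :: "mat3 \<Rightarrow> mat3 set" where
  "tangent_SO3 p = (\<lambda>A. p ** A) ` so3"

definition inner_product_on :: "mat3 set \<Rightarrow> (mat3 \<Rightarrow> mat3 \<Rightarrow> real) \<Rightarrow> bool" where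
  "inner_product_on S h \<longleftrightarrow>
     (\<forall>U\<in>S. \<forall>V\<in>S. h U V = h V U) \<and>
     (\<forall>U\<in>S. \<forall>V\<in>S. \<forall>W\<in>S. \<forall>a. h (a *\<^sub>R U + V) W = a * h U W + h V W) \<and>
     (\<forall>U\<in>S. U \<noteq> 0 \<longrightarrow> h U U > 0)"

text \<open>\<open>g p\<close> is the metric at \<open>p\<close>; only its values on tangent vectors at points of \<open>SO3\<close> matter.
  Smoothness in \<open>p\<close> is a consequence of left invariance.\<close>

definition biinvariant_metric :: "(mat3 \<Rightarrow> mat3 \<Rightarrow> mat3 \<Rightarrow> real) \<Rightarrow> bool" where
  "biinvariant_metric g \<longleftrightarrow>
     (\<forall>p\<in>SO3. inner_product_on (tangent_SO3 p) (g p)) \<and>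
     (\<forall>p\<in>SO3. \<forall>q\<in>SO3. \<forall>U\<in>tangent_SO3 p. \<forall>V\<in>tangent_SO3 p.
        g (q ** p) (q ** U) (q ** V) = g p U V \<and>
        g (p ** q) (U ** q) (V ** q) = g p U V)"

text \<open>The basis \<open>X 1, X 2, X 3\<close> fixes the scale of the metric and, by being declared positive, the
  orientation.\<close>

definition normalized_basis ::
  "(mat3 \<Rightarrow> mat3 \<Rightarrow> mat3 \<Rightarrow> real) \<Rightarrow> (3 \<Rightarrow> mat3) \<Rightarrow> bool" where
  "normalized_basis g X \<longleftrightarrow>
     (\<forall>i. X i \<in> so3) \<and>
     (\<forall>i j. g (mat 1) (X i) (X j) = (if i = j then 1 else 0)) \<and>
     lie_bracket (X 1) (X 2) = X 3 \<and>
     lie_bracket (X 2) (X 3) = X 1 \<and>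
     lie_bracket (X 3) (X 1) = X 2"


section \<open>Curves and vector fields along them\<close>

text \<open>Smoothness on an interval that may contain its end points (one-sided derivatives there).\<close>

definition smooth_on :: "real set \<Rightarrow> (real \<Rightarrow> 'a::real_normed_vector) \<Rightarrow> bool" where
  "smooth_on I f \<longleftrightarrow>
     (\<exists>F. F 0 = f \<and>
        (\<forall>n. \<forall>s\<in>I. (F n has_vector_derivative F (Suc n) s) (at s within I)))"

definition arc_length_curve ::
  "(mat3 \<Rightarrow> mat3 \<Rightarrow> mat3 \<Rightarrow> real) \<Rightarrow> real set \<Rightarrow> (real \<Rightarrow> mat3) \<Rightarrow> bool" where
  "arc_length_curve g I \<alpha> \<longleftrightarrow>
     is_interval I \<and> (\<exists>a\<in>I. \<exists>b\<in>I. a < b) \<and>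
     \<alpha> ` I \<subseteq> SO3 \<and> smooth_on I \<alpha> \<and>
     (\<forall>s\<in>I. let v = vector_derivative \<alpha> (at s within I) in g (\<alpha> s) v v = 1)"

text \<open>A vector field \<open>W = \<Sum>i. w\<^sub>i X\<^sub>i\<close> along a curve is represented by its component function
  \<open>real \<Rightarrow> real^3\<close>; hence \<open>dW/ds\<close> is just the derivative of that function.
  \<open>tangent_vec X p w\<close> is the actual tangent vector at \<open>p\<close> with components \<open>w\<close>.\<close>

definition tangent_vec :: "(3 \<Rightarrow> mat3) \<Rightarrow> mat3 \<Rightarrow> real^3 \<Rightarrow> mat3" where
  "tangent_vec X p w = (\<Sum>i\<in>UNIV. (w $ i) *\<^sub>R (p ** X i))"

text \<open>The components of \<open>\<Sum>i j. w\<^sub>i z\<^sub>j [X\<^sub>i, X\<^sub>j]\<close> in the orthonormal basis \<open>X\<close>.\<close>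

definition field_bracket ::
  "(mat3 \<Rightarrow> mat3 \<Rightarrow> mat3 \<Rightarrow> real) \<Rightarrow> (3 \<Rightarrow> mat3) \<Rightarrow> real^3 \<Rightarrow> real^3 \<Rightarrow> real^3" where
  "field_bracket g X w z =
     (\<chi> k. g (mat 1)
        (\<Sum>i\<in>UNIV. \<Sum>j\<in>UNIV. (w $ i * z $ j) *\<^sub>R lie_bracket (X i) (X j)) (X k))"

text \<open>The Levi-Civita connection of a bi-invariant metric satisfies \<open>D\<^sub>X Y = [X, Y] / 2\<close> on
  left-invariant fields; for a field \<open>W\<close> along a curve with velocity \<open>T\<close> this gives
  \<open>dW/ds + [T, W] / 2\<close>.\<close>

definition cov_deriv ::
  "(mat3 \<Rightarrow> mat3 \<Rightarrow> mat3 \<Rightarrow> real) \<Rightarrow> (3 \<Rightarrow> mat3) \<Rightarrow> real set \<Rightarrow>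
   (real \<Rightarrow> real^3) \<Rightarrow> (real \<Rightarrow> real^3) \<Rightarrow> real \<Rightarrow> real^3" where
  "cov_deriv g X I T W s =
     vector_derivative W (at s within I) + (1/2) *\<^sub>R field_bracket g X (T s) (W s)"

text \<open>A smooth positively oriented orthonormal frame along \<open>\<alpha>\<close> whose first member is the
  velocity. The determinant is that of the components in the positive basis \<open>X\<close>.\<close>

definition adapted_frame ::
  "(mat3 \<Rightarrow> mat3 \<Rightarrow> mat3 \<Rightarrow> real) \<Rightarrow> (3 \<Rightarrow> mat3) \<Rightarrow> real set \<Rightarrow> (real \<Rightarrow> mat3) \<Rightarrow>
   (real \<Rightarrow> real^3) \<Rightarrow> (real \<Rightarrow> real^3) \<Rightarrow> (real \<Rightarrow> real^3) \<Rightarrow> bool" where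
  "adapted_frame g X I \<alpha> T N B \<longleftrightarrow>
     smooth_on I T \<and> smooth_on I N \<and> smooth_on I B \<and>
     (\<forall>s\<in>I.
        (\<alpha> has_vector_derivative tangent_vec X (\<alpha> s) (T s)) (at s within I) \<and>
        (let m = (\<lambda>w z. g (\<alpha> s) (tangent_vec X (\<alpha> s) w) (tangent_vec X (\<alpha> s) z)) in
           m (T s) (T s) = 1 \<and> m (N s) (N s) = 1 \<and> m (B s) (B s) = 1 \<and>
           m (T s) (N s) = 0 \<and> m (T s) (B s) = 0 \<and> m (N s) (B s) = 0) \<and>
        det (vector [T s, N s, B s] :: mat3) > 0)"

definition frenet_apparatus ::
  "(mat3 \<Rightarrow> mat3 \<Rightarrow> mat3 \<Rightarrow> real) \<Rightarrow> (3 \<Rightarrow> mat3) \<Rightarrow> real set \<Rightarrow> (real \<Rightarrow> mat3) \<Rightarrow>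
   (real \<Rightarrow> real^3) \<Rightarrow> (real \<Rightarrow> real^3) \<Rightarrow> (real \<Rightarrow> real^3) \<Rightarrow>
   (real \<Rightarrow> real) \<Rightarrow> (real \<Rightarrow> real) \<Rightarrow> bool" where
  "frenet_apparatus g X I \<alpha> T N B \<kappa> \<tau> \<longleftrightarrow>
     adapted_frame g X I \<alpha> T N B \<and>
     (\<forall>s\<in>I.
        (let v = tangent_vec X (\<alpha> s) (vector_derivative T (at s within I))
         in \<kappa> s = sqrt (g (\<alpha> s) v v)) \<and> \<kappa> s \<noteq> 0 \<and>
        cov_deriv g X I T T s = \<kappa> s *\<^sub>R N s \<and>
        cov_deriv g X I T N s = - \<kappa> s *\<^sub>R T s + \<tau> s *\<^sub>R B s \<and>
        cov_deriv g X I T B s = - \<tau> s *\<^sub>R N s)"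

definition frenet_equations ::
  "real set \<Rightarrow> (real \<Rightarrow> real^3) \<Rightarrow> (real \<Rightarrow> real^3) \<Rightarrow> (real \<Rightarrow> real^3) \<Rightarrow>
   (real \<Rightarrow> real) \<Rightarrow> (real \<Rightarrow> real) \<Rightarrow> bool" where
  "frenet_equations I T N B \<kappa> \<tau> \<longleftrightarrow>
     (\<forall>s\<in>I.
        (T has_vector_derivative \<kappa> s *\<^sub>R N s) (at s within I) \<and>
        (N has_vector_derivative - \<kappa> s *\<^sub>R T s + (\<tau> s - 1/2) *\<^sub>R B s) (at s within I) \<and>
        (B has_vector_derivative - (\<tau> s - 1/2) *\<^sub>R N s) (at s within I))"


section \<open>Spinors\<close>

type_synonym spinor = "complex^2"

definition mate :: "spinor \<Rightarrow> spinor" where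
  "mate \<phi> = vector [- cnj (\<phi> $ 2), cnj (\<phi> $ 1)]"

definition \<sigma>\<^sub>1 :: "complex^2^2" where "\<sigma>\<^sub>1 = vector [vector [1, 0], vector [0, -1]]"
definition \<sigma>\<^sub>2 :: "complex^2^2" where "\<sigma>\<^sub>2 = vector [vector [\<i>, 0], vector [0, \<i>]]"
definition \<sigma>\<^sub>3 :: "complex^2^2" where "\<sigma>\<^sub>3 = vector [vector [0, -1], vector [-1, 0]]"

text \<open>\<open>dot2\<close> is the complex-bilinear product \<open>\<psi>\<^sup>t \<phi>\<close> without conjugation, unlike the library's
  real-valued \<open>inner\<close>.\<close>

definition dot2 :: "spinor \<Rightarrow> spinor \<Rightarrow> complex" where
  "dot2 \<psi> \<phi> = (\<Sum>i\<in>UNIV. \<psi> $ i * \<phi> $ i)"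

definition sigma_form :: "spinor \<Rightarrow> spinor \<Rightarrow> complex^3" where
  "sigma_form \<psi> \<phi> = vector [dot2 \<psi> (\<sigma>\<^sub>1 *v \<phi>), dot2 \<psi> (\<sigma>\<^sub>2 *v \<phi>), dot2 \<psi> (\<sigma>\<^sub>3 *v \<phi>)]"

definition complex_vec :: "real^3 \<Rightarrow> complex^3" where
  "complex_vec w = (\<chi> k. complex_of_real (w $ k))"

definition represents_triad ::
  "real set \<Rightarrow> (real \<Rightarrow> spinor) \<Rightarrow>
   (real \<Rightarrow> real^3) \<Rightarrow> (real \<Rightarrow> real^3) \<Rightarrow> (real \<Rightarrow> real^3) \<Rightarrow> bool" where
  "represents_triad I \<phi> N B T \<longleftrightarrow>
     \<phi> differentiable_on I \<and>
     (\<forall>s\<in>I.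
        complex_vec (N s) + \<i> *s complex_vec (B s) = sigma_form (\<phi> s) (\<phi> s) \<and>
        complex_vec (T s) = - sigma_form (mate (\<phi> s)) (\<phi> s) \<and>
        dot2 (\<chi> i. cnj (\<phi> s $ i)) (\<phi> s) = 1)"

definition spinor_equation ::
  "real set \<Rightarrow> (real \<Rightarrow> spinor) \<Rightarrow> (real \<Rightarrow> real) \<Rightarrow> (real \<Rightarrow> real) \<Rightarrow> bool" where
  "spinor_equation I \<phi> \<kappa> \<tau> \<longleftrightarrow>
     (\<forall>s\<in>I.
        (\<phi> has_vector_derivative
           (- \<i> * complex_of_real ((\<tau> s - 1/2) / 2)) *s \<phi> s
             + complex_of_real (\<kappa> s / 2) *s mate (\<phi> s)) (at s within I))"

end

theory Submission imports Defs begin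

text \<open>Write \<open>c = \<tau> - 1/2\<close>. The form \<open>(\<psi>, \<phi>) \<mapsto> \<psi>\<^sup>t \<sigma> \<phi>\<close> is complex-bilinear and symmetric, so along
  a spinor with derivative \<open>p\<close> the field \<open>N + \<i>B = \<phi>\<^sup>t \<sigma> \<phi>\<close> has derivative \<open>2 \<phi>\<^sup>t \<sigma> p\<close>, and the
  derivative of \<open>T\<close> is given by \<open>p\<close> in the same way. For \<open>q = - \<i> (c/2) \<phi> + (\<kappa>/2) mate \<phi>\<close> bilinearity and
  \<open>(mate \<phi>)\<^sup>t \<sigma> \<phi> = - T\<close> give \<open>2 \<phi>\<^sup>t \<sigma> q = - \<i>c (N + \<i>B) - \<kappa>T\<close>, which is the derivative of \<open>N + \<i>B\<close>
  prescribed by the equations for \<open>dN/ds\<close> and \<open>dB/ds\<close>. A similar computation gives \<open>\<kappa>N\<close> for \<open>dT/ds\<close>.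
  Hence the spinor equation implies the Frenet equations. Conversely, the Frenet equations imply
  that \<open>\<phi>\<^sup>t \<sigma> (p - q) = 0\<close>, and \<open>\<phi>\<^sup>t \<sigma> d = 0\<close> with \<open>\<phi> \<noteq> 0\<close> forces \<open>d = 0\<close>.

  That the Frenet apparatus satisfies the stated equations amounts to the fact that in the
  normalized basis the bracket is the cross product, so that
  \<open>[T, N] = B\<close>, \<open>[T, B] = - N\<close>, and the term \<open>[T, W] / 2\<close> of the covariant derivative
  accounts exactly for the shift of \<open>\<tau>\<close> by \<open>1/2\<close>.\<close>

section \<open>Algebra of the spinor form\<close>

lemma sigma_form_nth:
  "sigma_form \<psi> \<phi> $ 1 = \<psi> $ 1 * \<phi> $ 1 - \<psi> $ 2 * \<phi> $ 2"
  "sigma_form \<psi> \<phi> $ 2 = \<i> * (\<psi> $ 1 * \<phi> $ 1 + \<psi> $ 2 * \<phi> $ 2)"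
  "sigma_form \<psi> \<phi> $ 3 = - (\<psi> $ 1 * \<phi> $ 2 + \<psi> $ 2 * \<phi> $ 1)"
  by (simp_all add: sigma_form_def dot2_def \<sigma>\<^sub>1_def \<sigma>\<^sub>2_def \<sigma>\<^sub>3_def matrix_vector_mult_def
      sum_2 algebra_simps)

lemma mate_nth: "mate \<phi> $ 1 = - cnj (\<phi> $ 2)" "mate \<phi> $ 2 = cnj (\<phi> $ 1)"
  by (simp_all add: mate_def)

lemma sigma_form_commute: "sigma_form \<psi> \<phi> = sigma_form \<phi> \<psi>"
  by (simp add: vec_eq_iff forall_3 sigma_form_nth algebra_simps)

lemma sigma_form_combination_right:
  "sigma_form \<psi> (a *s \<phi> + b *s \<zeta>) = a *s sigma_form \<psi> \<phi> + b *s sigma_form \<psi> \<zeta>"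
  by (simp add: vec_eq_iff forall_3 sigma_form_nth algebra_simps)

lemma sigma_form_diff_right: "sigma_form \<psi> (\<phi> - \<zeta>) = sigma_form \<psi> \<phi> - sigma_form \<psi> \<zeta>"
  by (simp add: vec_eq_iff forall_3 sigma_form_nth algebra_simps)

lemma sigma_form_eq_0_imp:
  assumes "\<phi> \<noteq> 0" and "sigma_form \<phi> d = 0"
  shows "d = 0"
proof -
  have "sigma_form \<phi> d $ k = 0" for k
    using assms(2) by simp
  from this[of 1] this[of 2] this[of 3]
  have diag: "\<phi> $ 1 * d $ 1 = \<phi> $ 2 * d $ 2" "\<phi> $ 1 * d $ 1 + \<phi> $ 2 * d $ 2 = 0"
    and off: "\<phi> $ 1 * d $ 2 + \<phi> $ 2 * d $ 1 = 0"
    by (simp_all only: sigma_form_nth) (simp_all add: neg_eq_iff_add_eq_0)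
  from diag have "\<phi> $ 1 * d $ 1 = 0" "\<phi> $ 2 * d $ 2 = 0"
    by simp_all
  with off assms(1) show ?thesis
    by (auto simp: vec_eq_iff forall_2)
qed

lemma bounded_bilinear_sigma_form: "bounded_bilinear sigma_form"
proof -
  have "linear (sigma_form \<psi>)" for \<psi>
    by (rule linearI) (simp_all add: vec_eq_iff forall_3 sigma_form_nth distrib_left scaleR_add_right
        scaleR_diff_right)
  moreover from this have "linear (\<lambda>\<psi>. sigma_form \<psi> \<phi>)" for \<phi>
    by (subst sigma_form_commute)
  ultimately have "bilinear sigma_form"
    by (simp add: bilinear_def)
  then show ?thesis
    by (simp add: bilinear_conv_bounded_bilinear)
qed

lemma bounded_linear_mate: "bounded_linear mate"
proof -
  have "linear mate"
    by (intro linearI) (simp_all add: vec_eq_iff forall_2 mate_nth)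
  then show ?thesis
    by (simp add: linear_conv_bounded_linear)
qed

text \<open>Componentwise real and imaginary parts of a vector in \<open>\<complex>\<^sup>3\<close>.\<close>

definition re_vec :: "complex^3 \<Rightarrow> real^3" where
  "re_vec z = (\<chi> k. Re (z $ k))"

definition im_vec :: "complex^3 \<Rightarrow> real^3" where
  "im_vec z = (\<chi> k. Im (z $ k))"

lemma bounded_linear_re_vec: "bounded_linear re_vec"
  by (simp add: re_vec_def linear_conv_bounded_linear[symmetric] linear_iff vec_eq_iff)

lemma bounded_linear_im_vec: "bounded_linear im_vec"
  by (simp add: im_vec_def linear_conv_bounded_linear[symmetric] linear_iff vec_eq_iff)

lemma complex_vec_re_im: "complex_vec (re_vec z) + \<i> *s complex_vec (im_vec z) = z"
  by (simp add: vec_eq_iff complex_vec_def re_vec_def im_vec_def complex_eq_iff)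

lemma re_vec_complex: "re_vec (complex_vec v + \<i> *s complex_vec w) = v"
  and im_vec_complex: "im_vec (complex_vec v + \<i> *s complex_vec w) = w"
  by (simp_all add: vec_eq_iff complex_vec_def re_vec_def im_vec_def)

section \<open>The triad of a spinor\<close>

lemma represents_triadD:
  assumes "represents_triad I \<phi> N B T" and "s \<in> I"
  shows "complex_vec (N s) + \<i> *s complex_vec (B s) = sigma_form (\<phi> s) (\<phi> s)"
    and "sigma_form (mate (\<phi> s)) (\<phi> s) = - complex_vec (T s)"
    and "N s = re_vec (sigma_form (\<phi> s) (\<phi> s))"
    and "B s = im_vec (sigma_form (\<phi> s) (\<phi> s))"
    and "T s = re_vec (- sigma_form (mate (\<phi> s)) (\<phi> s))"
    and "cnj (\<phi> s $ 1) * \<phi> s $ 1 + cnj (\<phi> s $ 2) * \<phi> s $ 2 = 1"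
    and "\<phi> s \<noteq> 0"
proof -
  show NB: "complex_vec (N s) + \<i> *s complex_vec (B s) = sigma_form (\<phi> s) (\<phi> s)"
    using assms by (simp add: represents_triad_def)
  have T: "complex_vec (T s) = - sigma_form (mate (\<phi> s)) (\<phi> s)"
    using assms by (simp add: represents_triad_def)
  then show "sigma_form (mate (\<phi> s)) (\<phi> s) = - complex_vec (T s)"
    by simp
  show "N s = re_vec (sigma_form (\<phi> s) (\<phi> s))" "B s = im_vec (sigma_form (\<phi> s) (\<phi> s))"
    by (simp_all add: NB[symmetric] re_vec_complex im_vec_complex)
  show "T s = re_vec (- sigma_form (mate (\<phi> s)) (\<phi> s))"
    unfolding T[symmetric] by (simp add: vec_eq_iff complex_vec_def re_vec_def)
  show "cnj (\<phi> s $ 1) * \<phi> s $ 1 + cnj (\<phi> s $ 2) * \<phi> s $ 2 = 1"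
    using assms by (simp add: represents_triad_def dot2_def sum_2)
  then show "\<phi> s \<noteq> 0"
    by auto
qed

lemma represents_triad_cross3:
  assumes "represents_triad I \<phi> N B T" and "s \<in> I"
  shows "cross3 (T s) (N s) = B s" and "cross3 (T s) (B s) = - N s"
proof -
  obtain a b c d where \<phi>: "\<phi> s $ 1 = Complex a b" "\<phi> s $ 2 = Complex c d"
    by (metis complex.exhaust)
  have unit: "a * a + b * b + c * c + d * d = 1"
    using represents_triadD(6)[OF assms] by (simp add: \<phi> complex_eq_iff)
  have N: "N s $ 1 = a*a - b*b - c*c + d*d" "N s $ 2 = - 2 * (a*b + c*d)"
    "N s $ 3 = - 2 * (a*c - b*d)"
    by (simp_all add: represents_triadD(3)[OF assms] re_vec_def sigma_form_nth \<phi> algebra_simps)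
  have B: "B s $ 1 = 2 * (a*b - c*d)" "B s $ 2 = a*a - b*b + c*c - d*d"
    "B s $ 3 = - 2 * (a*d + b*c)"
    by (simp_all add: represents_triadD(4)[OF assms] im_vec_def sigma_form_nth \<phi> algebra_simps)
  have T: "T s $ 1 = 2 * (a*c + b*d)" "T s $ 2 = 2 * (a*d - b*c)"
    "T s $ 3 = a*a + b*b - c*c - d*d"
    by (simp_all add: represents_triadD(5)[OF assms] re_vec_def sigma_form_nth mate_nth \<phi>
        algebra_simps)
  \<comment> \<open>\<open>T \<times> N\<close> and \<open>T \<times> B\<close> are homogeneous of degree four in the spinor: they equal \<open>B\<close> and \<open>- N\<close>
    multiplied by the squared norm of the spinor.\<close>
  have "cross3 (T s) (N s) = (a * a + b * b + c * c + d * d) *\<^sub>R B s"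
    by (simp add: vec_eq_iff forall_3 cross3_def N B T algebra_simps)
  then show "cross3 (T s) (N s) = B s"
    by (simp add: unit)
  have "cross3 (T s) (B s) = (a * a + b * b + c * c + d * d) *\<^sub>R (- N s)"
    by (simp add: vec_eq_iff forall_3 cross3_def N B T algebra_simps)
  then show "cross3 (T s) (B s) = - N s"
    by (simp add: unit)
qed

lemma represents_triad_has_vector_derivative:
  assumes "represents_triad I \<phi> N B T" and "s \<in> I"
    and "(\<phi> has_vector_derivative p) (at s within I)"
  shows "(N has_vector_derivative re_vec (2 *s sigma_form (\<phi> s) p)) (at s within I)"
    and "(B has_vector_derivative im_vec (2 *s sigma_form (\<phi> s) p)) (at s within I)"
    and "(T has_vector_derivative
           re_vec (- (sigma_form (mate (\<phi> s)) p + sigma_form (mate p) (\<phi> s)))) (at s within I)"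
proof -
  note triad = represents_triadD[OF assms(1)]
  have "sigma_form (\<phi> s) p + sigma_form p (\<phi> s) = 2 *s sigma_form (\<phi> s) p"
    by (simp add: vec_eq_iff sigma_form_commute[of p])
  with bounded_bilinear.has_vector_derivative[OF bounded_bilinear_sigma_form assms(3) assms(3)]
  have F: "((\<lambda>t. sigma_form (\<phi> t) (\<phi> t)) has_vector_derivative 2 *s sigma_form (\<phi> s) p)
      (at s within I)"
    by simp
  show "(N has_vector_derivative re_vec (2 *s sigma_form (\<phi> s) p)) (at s within I)"
    by (rule has_vector_derivative_transform[OF assms(2) triad(3)
          bounded_linear.has_vector_derivative[OF bounded_linear_re_vec F]])
  show "(B has_vector_derivative im_vec (2 *s sigma_form (\<phi> s) p)) (at s within I)"
    by (rule has_vector_derivative_transform[OF assms(2) triad(4)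
          bounded_linear.has_vector_derivative[OF bounded_linear_im_vec F]])
  have "((\<lambda>t. - sigma_form (mate (\<phi> t)) (\<phi> t)) has_vector_derivative
      - (sigma_form (mate (\<phi> s)) p + sigma_form (mate p) (\<phi> s))) (at s within I)"
    by (intro has_vector_derivative_minus
        bounded_bilinear.has_vector_derivative[OF bounded_bilinear_sigma_form]
        bounded_linear.has_vector_derivative[OF bounded_linear_mate] assms(3))
  from has_vector_derivative_transform[OF assms(2) triad(5)
      bounded_linear.has_vector_derivative[OF bounded_linear_re_vec this]]
  show "(T has_vector_derivative
      re_vec (- (sigma_form (mate (\<phi> s)) p + sigma_form (mate p) (\<phi> s)))) (at s within I)" .
qed

section \<open>The Frenet equations and the spinor equation at a point\<close>

text \<open>In the next lemmas \<open>k\<close> and \<open>c\<close> stand for the values of \<open>\<kappa>\<close> and \<open>\<tau> - 1/2\<close> at the point.\<close>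

lemma sigma_form_spinor_rhs:
  assumes "represents_triad I \<phi> N B T" and "s \<in> I"
    and q: "q = (- \<i> * complex_of_real (c / 2)) *s \<phi> s + complex_of_real (k / 2) *s mate (\<phi> s)"
  shows "2 *s sigma_form (\<phi> s) q =
      complex_vec (- k *\<^sub>R T s + c *\<^sub>R B s) + \<i> *s complex_vec (- c *\<^sub>R N s)"
    and "re_vec (- (sigma_form (mate (\<phi> s)) q + sigma_form (mate q) (\<phi> s))) = k *\<^sub>R N s"
proof -
  note triad = represents_triadD[OF assms(1,2)]
  have "2 *s sigma_form (\<phi> s) q =
      (- \<i> * complex_of_real c) *s (complex_vec (N s) + \<i> *s complex_vec (B s))
      - complex_of_real k *s complex_vec (T s)"
    unfolding q sigma_form_combination_right sigma_form_commute[of "\<phi> s" "mate (\<phi> s)"] triad(2)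
      triad(1)[symmetric]
    by (simp add: vec_eq_iff algebra_simps)
  then show "2 *s sigma_form (\<phi> s) q =
      complex_vec (- k *\<^sub>R T s + c *\<^sub>R B s) + \<i> *s complex_vec (- c *\<^sub>R N s)"
    by (simp add: vec_eq_iff complex_vec_def complex_eq_iff)
  show "re_vec (- (sigma_form (mate (\<phi> s)) q + sigma_form (mate q) (\<phi> s))) = k *\<^sub>R N s"
    by (simp add: vec_eq_iff forall_3 triad(3) re_vec_def sigma_form_nth q mate_nth
        algebra_simps)
qed

lemma spinor_equation_imp_frenet_equations_at:
  assumes "represents_triad I \<phi> N B T" and "s \<in> I"
    and "(\<phi> has_vector_derivative
      (- \<i> * complex_of_real (c / 2)) *s \<phi> s + complex_of_real (k / 2) *s mate (\<phi> s))
      (at s within I)"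
  shows "(T has_vector_derivative k *\<^sub>R N s) (at s within I)"
    and "(N has_vector_derivative - k *\<^sub>R T s + c *\<^sub>R B s) (at s within I)"
    and "(B has_vector_derivative - c *\<^sub>R N s) (at s within I)"
  using represents_triad_has_vector_derivative[OF assms]
  unfolding sigma_form_spinor_rhs[OF assms(1,2) refl] re_vec_complex im_vec_complex
  by simp_all

text \<open>The equations for \<open>dN/ds\<close> and \<open>dB/ds\<close> alone already determine the derivative of the spinor.\<close>

lemma frenet_equations_imp_spinor_equation_at:
  assumes triad: "represents_triad I \<phi> N B T" and s: "s \<in> I" and lim: "at s within I \<noteq> bot"
    and N: "(N has_vector_derivative - k *\<^sub>R T s + c *\<^sub>R B s) (at s within I)"
    and B: "(B has_vector_derivative - c *\<^sub>R N s) (at s within I)"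
  shows "(\<phi> has_vector_derivative
      (- \<i> * complex_of_real (c / 2)) *s \<phi> s + complex_of_real (k / 2) *s mate (\<phi> s))
      (at s within I)"
    (is "(_ has_vector_derivative ?q) _")
proof -
  have "\<phi> differentiable (at s within I)"
    using triad s by (simp add: represents_triad_def differentiable_on_def)
  then obtain p where p: "(\<phi> has_vector_derivative p) (at s within I)"
    using vector_derivative_works by blast
  note unique = vector_derivative_unique_within[OF lim]
  have "2 *s sigma_form (\<phi> s) p =
      complex_vec (- k *\<^sub>R T s + c *\<^sub>R B s) + \<i> *s complex_vec (- c *\<^sub>R N s)"
    unfolding unique[OF N represents_triad_has_vector_derivative(1)[OF triad s p]]
      unique[OF B represents_triad_has_vector_derivative(2)[OF triad s p]]
    by (rule complex_vec_re_im[symmetric])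
  also have "\<dots> = 2 *s sigma_form (\<phi> s) ?q"
    by (rule sigma_form_spinor_rhs(1)[OF triad s refl, symmetric])
  finally have "sigma_form (\<phi> s) (p - ?q) = 0"
    unfolding sigma_form_diff_right by (simp add: vec_eq_iff)
  then have "p = ?q"
    using sigma_form_eq_0_imp[OF represents_triadD(7)[OF triad s]] by fastforce
  with p show ?thesis
    by simp
qed

section \<open>The covariant derivative in the normalized basis\<close>

text \<open>The normalization \<open>[X 1, X 2] = X 3\<close> (and cyclically) turns the bracket into the cross
  product of component vectors.\<close>

lemma field_bracket_eq_cross3:
  assumes g: "biinvariant_metric g" and X: "normalized_basis g X"
  shows "field_bracket g X w z = cross3 w z"
proof -
  let ?h = "g (mat 1)"
  have "mat 1 \<in> SO3"
    by (simp add: SO3_def rotation_matrix_def orthogonal_matrix_id)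
  moreover have "tangent_SO3 (mat 1) = so3"
    by (simp add: tangent_SO3_def)
  ultimately have "inner_product_on so3 ?h"
    using g unfolding biinvariant_metric_def by metis
  then have lin: "?h (a *\<^sub>R U + V) W = a * ?h U W + ?h V W"
    if "U \<in> so3" "V \<in> so3" "W \<in> so3" for a U V W
    using that unfolding inner_product_on_def by blast
  have X_so3: "X i \<in> so3" for i
    using X by (simp add: normalized_basis_def)
  have orthonormal: "?h (X i) (X j) = (if i = j then 1 else 0)" for i j
    using X by (simp add: normalized_basis_def)
  have so3_comb: "a *\<^sub>R U + V \<in> so3" if "U \<in> so3" "V \<in> so3" for a U V
  proof -
    have "transpose (a *\<^sub>R U + V) = a *\<^sub>R transpose U + transpose V"
      by (simp add: transpose_def vec_eq_iff)
    with that show ?thesis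
      by (simp add: so3_def)
  qed
  have so3_0: "0 \<in> so3"
    by (simp add: so3_def transpose_def vec_eq_iff)
  have h0: "?h 0 (X l) = 0" for l
    using lin[OF so3_0 so3_0 X_so3, of 1 l] by simp
  have bracket:
    "lie_bracket (X 1) (X 2) = X 3" "lie_bracket (X 2) (X 3) = X 1" "lie_bracket (X 3) (X 1) = X 2"
    using X by (simp_all add: normalized_basis_def)
  have anti: "lie_bracket A C = - lie_bracket C A" for A C
    by (simp add: lie_bracket_def)
  have self: "lie_bracket A A = 0" for A
    by (simp add: lie_bracket_def)
  have bracket':
    "lie_bracket (X 2) (X 1) = - X 3" "lie_bracket (X 3) (X 2) = - X 1"
    "lie_bracket (X 1) (X 3) = - X 2"
    using anti[of "X 2" "X 1"] anti[of "X 3" "X 2"] anti[of "X 1" "X 3"]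
    by (simp_all only: bracket)
  \<comment> \<open>The final \<open>0\<close> gives the sum the nested shape \<open>a *\<^sub>R U + V\<close> on which \<open>lin\<close> acts.\<close>
  have expand: "(\<Sum>i\<in>UNIV. \<Sum>j\<in>UNIV. (w $ i * z $ j) *\<^sub>R lie_bracket (X i) (X j)) =
      (cross3 w z $ 1) *\<^sub>R X 1 + ((cross3 w z $ 2) *\<^sub>R X 2 + ((cross3 w z $ 3) *\<^sub>R X 3 + 0))"
    by (simp add: sum_3 bracket bracket' self cross3_def algebra_simps)
  have "?h (a *\<^sub>R X 1 + (b *\<^sub>R X 2 + (c *\<^sub>R X 3 + 0))) (X l) =
      a * ?h (X 1) (X l) + (b * ?h (X 2) (X l) + (c * ?h (X 3) (X l) + 0))" for a b c l
    by (simp only: lin so3_comb so3_0 X_so3 h0)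
  then show ?thesis
    unfolding field_bracket_def expand
    by (simp add: vec_eq_iff forall_3 orthonormal del: add_0_right)
qed

lemma frenet_apparatus_imp_frenet_equations:
  assumes g: "biinvariant_metric g" and X: "normalized_basis g X"
    and triad: "represents_triad I \<phi> N B T"
    and app: "frenet_apparatus g X I \<alpha> T N B \<kappa> \<tau>"
  shows "frenet_equations I T N B \<kappa> \<tau>"
  unfolding frenet_equations_def
proof (intro ballI)
  fix s assume s: "s \<in> I"
  have deriv: "(W has_vector_derivative vector_derivative W (at s within I)) (at s within I)"
    if "smooth_on I W" for W :: "real \<Rightarrow> real^3"
  proof -
    from that s obtain W' where "(W has_vector_derivative W') (at s within I)"
      unfolding smooth_on_def by metis
    then show ?thesis
      using vector_derivative_works differentiableI_vector by blast
  qed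
  have smooth: "smooth_on I T" "smooth_on I N" "smooth_on I B"
    using app by (simp_all add: frenet_apparatus_def adapted_frame_def)
  have cov: "cov_deriv g X I T W s = vector_derivative W (at s within I)
      + (1/2) *\<^sub>R cross3 (T s) (W s)" for W
    by (simp add: cov_deriv_def field_bracket_eq_cross3[OF g X])
  have "cov_deriv g X I T T s = \<kappa> s *\<^sub>R N s"
    "cov_deriv g X I T N s = - \<kappa> s *\<^sub>R T s + \<tau> s *\<^sub>R B s"
    "cov_deriv g X I T B s = - \<tau> s *\<^sub>R N s"
    using app s by (simp_all add: frenet_apparatus_def)
  then have "vector_derivative T (at s within I) = \<kappa> s *\<^sub>R N s"
    "vector_derivative N (at s within I) = - \<kappa> s *\<^sub>R T s + (\<tau> s - 1/2) *\<^sub>R B s"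
    "vector_derivative B (at s within I) = - (\<tau> s - 1/2) *\<^sub>R N s"
    unfolding cov represents_triad_cross3[OF triad s] cross_refl
    by (simp_all add: algebra_simps)
  with smooth[THEN deriv]
  show "(T has_vector_derivative \<kappa> s *\<^sub>R N s) (at s within I) \<and>
        (N has_vector_derivative - \<kappa> s *\<^sub>R T s + (\<tau> s - 1/2) *\<^sub>R B s) (at s within I) \<and>
        (B has_vector_derivative - (\<tau> s - 1/2) *\<^sub>R N s) (at s within I)"
    by metis
qed

section \<open>Equivalence along the curve\<close>

theorem corollary3p4:
  fixes g :: "mat3 \<Rightarrow> mat3 \<Rightarrow> mat3 \<Rightarrow> real" and X :: "3 \<Rightarrow> mat3"
    and I :: "real set" and \<alpha> :: "real \<Rightarrow> mat3"
    and T N B :: "real \<Rightarrow> real^3" and \<kappa> \<tau> :: "real \<Rightarrow> real"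
    and \<phi> :: "real \<Rightarrow> spinor"
  assumes "biinvariant_metric g" and "normalized_basis g X"
    and "arc_length_curve g I \<alpha>"
    and "adapted_frame g X I \<alpha> T N B"
    and "represents_triad I \<phi> N B T"
  shows "(frenet_equations I T N B \<kappa> \<tau> \<longleftrightarrow> spinor_equation I \<phi> \<kappa> \<tau>) \<and>
         (frenet_apparatus g X I \<alpha> T N B \<kappa> \<tau> \<longrightarrow>
            frenet_equations I T N B \<kappa> \<tau> \<and> spinor_equation I \<phi> \<kappa> \<tau>)"
proof -
  \<comment> \<open>Derivatives within \<open>I\<close> are unique because the interval is nondegenerate.\<close>
  have lim: "at s within I \<noteq> bot" if "s \<in> I" for s
  proof -
    have "connected I" "\<not> (\<exists>x. I = {x})"
      using assms(3) by (auto simp: arc_length_curve_def is_interval_connected)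
    then have "s islimpt I"
      using that connected_imp_perfect by blast
    then show ?thesis
      by (simp add: trivial_limit_within)
  qed
  have "frenet_equations I T N B \<kappa> \<tau> \<longleftrightarrow> spinor_equation I \<phi> \<kappa> \<tau>"
  proof
    assume "frenet_equations I T N B \<kappa> \<tau>"
    then show "spinor_equation I \<phi> \<kappa> \<tau>"
      unfolding spinor_equation_def frenet_equations_def
      using frenet_equations_imp_spinor_equation_at[OF assms(5) _ lim] by blast
  next
    assume "spinor_equation I \<phi> \<kappa> \<tau>"
    then show "frenet_equations I T N B \<kappa> \<tau>"
      unfolding spinor_equation_def frenet_equations_def
      using spinor_equation_imp_frenet_equations_at[OF assms(5)] by blast
  qed
  with frenet_apparatus_imp_frenet_equations[OF assms(1,2,5)] show ?thesis
    by blast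
qed

end
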